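(* Let $m,n,k$ be positive integers with $2\le k\le m\le n$, and let $t=m-k$ or $t=m-k+1$. Then the number of maximal $I_k$-avoiding $(0,1)$-fillings of $\bar{R}_{m,n;t}$ is $$|\mathcal{F}_{\bar{R}_{m,n;t};k}| = \prod_{i=1}^{k-1}\frac{(m+n-2k+2i+\delta_{t,m-k})!}{(m-i)!\,(n+i-1+\delta_{t,m-k})!}\cdot\prod_{i=1}^{k-2} i!\cdot\prod_{1\le i\le j\le k-1}(n-m+i+j-1+\delta_{t,m-k}),$$ where $\delta$ is the Kronecker delta.
   Context: Boxes are indexed by (row, column), with rows numbered from top to bottom and columns from left to right. $\bar{R}_{m,n;t}$ is the region obtained from the $m\times n$ rectangle by removing a staircase of size $t$ from the lower right corner: for $i=1,\dots,t$, the last $i$ boxes of row $m-t+i$ are removed. A $(0,1)$-filling $F$ of a region $R$ assigns $0$ or $1$ to each box of $R$. $F$ contains $I_k$ if there are rows $r_1<\dots<r_k$ and columns $c_1<\dots<c_k$ such that all boxes $(r_i,c_j)$, $1\le i,j\le k$, lie in $R$ and each box $(r_i,c_i)$ is filled with $1$ (the entries in boxes $(r_i,c_j)$ with $i\ne j$ are arbitrary). $F$ is $I_k$-avoiding if it does not contain $I_k$, and it is maximal if it has the maximum possible number of $1$'s among all $I_k$-avoiding $(0,1)$-fillings of $R$. $\mathcal{F}_{R;k}$ is the set of maximal $I_k$-avoiding $(0,1)$-fillings of $R$. Empty products equal $1$. *)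

theory Defs
  imports Complex_Main "HOL-Library.FuncSet"
begin

(* Boxes are pairs (row, column), both 1-based. *)
type_synonym box = "nat \<times> nat"

definition rect :: "nat \<Rightarrow> nat \<Rightarrow> box set" where
  "rect m n = {1..m} \<times> {1..n}"

(* The natural subtractions below are genuine ones as long as t \<le> m and t \<le> n. *)
definition lower_right_staircase :: "nat \<Rightarrow> nat \<Rightarrow> nat \<Rightarrow> box set" where
  "lower_right_staircase m n t = (\<Union>i\<in>{1..t}. {m - t + i} \<times> {n - i + 1..n})"

definition Rbar :: "nat \<Rightarrow> nat \<Rightarrow> nat \<Rightarrow> box set" where
  "Rbar m n t = rect m n - lower_right_staircase m n t"

(* Fillings are extensional functions, so that distinct fillings differ on the region. *)
definition fillings :: "box set \<Rightarrow> (box \<Rightarrow> nat) set" where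
  "fillings R = R \<rightarrow>\<^sub>E {0, 1}"

definition contains_I :: "box set \<Rightarrow> nat \<Rightarrow> (box \<Rightarrow> nat) \<Rightarrow> bool" where
  "contains_I R k F \<longleftrightarrow>
     (\<exists>r c :: nat \<Rightarrow> nat.
        strict_mono_on {1..k} r \<and> strict_mono_on {1..k} c \<and>
        (\<forall>i\<in>{1..k}. \<forall>j\<in>{1..k}. (r i, c j) \<in> R) \<and>
        (\<forall>i\<in>{1..k}. F (r i, c i) = 1))"

definition avoiding_fillings :: "box set \<Rightarrow> nat \<Rightarrow> (box \<Rightarrow> nat) set" where
  "avoiding_fillings R k = {F \<in> fillings R. \<not> contains_I R k F}"

definition num_ones :: "box set \<Rightarrow> (box \<Rightarrow> nat) \<Rightarrow> nat" where
  "num_ones R F = card {b \<in> R. F b = 1}"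

definition maximal_fillings :: "box set \<Rightarrow> nat \<Rightarrow> (box \<Rightarrow> nat) set" where
  "maximal_fillings R k =
     {F \<in> avoiding_fillings R k. \<forall>G \<in> avoiding_fillings R k. num_ones R G \<le> num_ones R F}"

definition kronecker_delta :: "nat \<Rightarrow> nat \<Rightarrow> nat" where
  "kronecker_delta a b = (if a = b then 1 else 0)"

end

theory Submission
  imports Defs "Jordan_Normal_Form.Determinant"
begin

text \<open>Let \<open>p = k - 1\<close>. Since the lower right box of a chain lies in the region, avoiding \<open>I_k\<close> means
  having no strictly south-east chain of \<open>k\<close> ones, so every diagonal carries at most \<open>p\<close> ones, and the
  filling with ones in the first \<open>p\<close> rows and columns is optimal on every diagonal at once. In a
  maximal filling the \<open>p\<close> ones on neighbouring diagonals interlace, so the filling is a family of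
  \<open>p\<close> nonintersecting lattice paths with fixed ends, where only the boundary \<open>i + j \<le> n + p\<close>
  matters. Such families are counted by a determinant of ballot numbers. As a function of the starting
  points this is, up to scaling of the rows, a determinant of odd polynomials of degree less
  than \<open>2 p\<close>, hence a Vandermonde determinant in the squares times a constant, which is found from
  the one family whose paths are all horizontal. The smaller staircase reduces to the larger one for
  \<open>n + 1\<close>, since the additional last column has fewer than \<open>k\<close> boxes.\<close>

section \<open>Determinants of ballot numbers\<close>

text \<open>An integer lower index, with value 0 below zero, lets Pascal's rule and symmetry hold
  without side conditions.\<close>

definition zbinom :: "nat \<Rightarrow> int \<Rightarrow> real" where
  "zbinom s k = (if k < 0 then 0 else real (s choose nat k))"

lemma zbinom_Suc: "zbinom (Suc s) k = zbinom s k + zbinom s (k - 1)"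
proof (cases "k \<le> 0")
  case False
  then obtain n where "k = int (Suc n)"
    by (metis gr0_implies_Suc int_nat_eq linorder_not_less nat_0_iff not_gr_zero of_nat_0_less_iff
        of_nat_0_le_iff order_less_imp_le zero_less_nat_eq nat_0_le)
  then show ?thesis by (simp add: zbinom_def nat_add_distrib)
qed (auto simp: zbinom_def)

lemma zbinom_symmetric: "zbinom s (int s - k) = zbinom s k"
proof (cases "0 \<le> k \<and> k \<le> int s")
  case True
  then obtain n where n: "k = int n" "n \<le> s"
    by (metis nonneg_int_cases of_nat_le_iff)
  then have "nat (int s - k) = s - n" by simp
  with n show ?thesis by (simp add: zbinom_def binomial_symmetric[of n s])
next
  case False
  then show ?thesis by (auto simp: zbinom_def)
qed

text \<open>By reflection, \<open>ballot s z l\<close> counts the sequences of \<open>s\<close> steps \<open>0\<close> or \<open>-1\<close> from \<open>z\<close> to \<open>-l\<close>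
  that never violate \<open>2 x \<le> r\<close>, where \<open>x\<close> is the current position and \<open>r\<close> the number of remaining
  steps; it vanishes just behind this wall.\<close>

definition ballot :: "nat \<Rightarrow> int \<Rightarrow> nat \<Rightarrow> real" where
  "ballot s z l = zbinom s (z + int l) - zbinom s (z - int l - 1)"

lemma ballot_Suc: "ballot (Suc s) z l = ballot s z l + ballot s (z - 1) l"
  by (simp add: ballot_def zbinom_Suc algebra_simps)

text \<open>The two lower indices add up to \<open>s\<close>, so the terms cancel by
  symmetry.\<close>

lemma ballot_wall:
  assumes "2 * z = int s + 1"
  shows "ballot s z l = 0"
proof -
  have "z - int l - 1 = int s - (z + int l)" using assms by simp
  then show ?thesis unfolding ballot_def by (metis diff_self zbinom_symmetric)
qed

text \<open>For \<open>z \<le> 0\<close> the reflected term has a negative lower index and drops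
  out.\<close>

lemma ballot_0: "z \<le> 0 \<Longrightarrow> ballot 0 z l = (if z = - int l then 1 else 0)"
  by (auto simp: ballot_def zbinom_def)

section \<open>Ballot numbers as polynomials in the starting point\<close>

definition fallfact :: "'a::comm_ring_1 \<Rightarrow> nat \<Rightarrow> 'a" where
  "fallfact x a = (\<Prod>i<a. x - of_nat i)"

lemma fallfact_fact: "a \<le> u \<Longrightarrow> fallfact (real u) a * fact (u - a) = fact u"
proof (induction a)
  case (Suc a)
  have e: "u - a = Suc (u - Suc a)" using Suc.prems by simp
  have "(fact (u - a) :: real) = (real u - real a) * fact (u - Suc a)"
    unfolding e fact_Suc using Suc.prems by (simp add: of_nat_diff)
  with Suc show ?case by (simp add: fallfact_def mult.assoc)
qed (simp add: fallfact_def)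

lemma fallfact_eq_0: "u < a \<Longrightarrow> fallfact (real u) a = 0"
  by (auto simp: fallfact_def)

text \<open>The complementary lower index is \<open>v - b\<close>, so the binomial is
  \<open>fact s / (fact (u - a) * fact (v - b))\<close>. Out of range, a falling factorial on the
  right contains the factor 0.\<close>

lemma zbinom_fallfact:
  assumes "u + v = s + a + b"
  shows "zbinom s (int u - int a) * fact u * fact v = fact s * fallfact (real u) a * fallfact (real v) b"
proof (cases "a \<le> u \<and> b \<le> v")
  case True
  then have e: "u - a \<le> s" "s - (u - a) = v - b" using assms by auto
  have "nat (int u - int a) = u - a" using True by auto
  then have "zbinom s (int u - int a) = fact s / (fact (u - a) * fact (v - b))"
    using True by (simp add: zbinom_def binomial_fact[OF e(1)] e(2))
  then show ?thesis
    using True by (simp add: fallfact_fact[of a u, symmetric] fallfact_fact[of b v, symmetric])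
next
  case False
  then consider "u < a" | "a \<le> u" "v < b" by linarith
  then show ?thesis
  proof cases
    case 2
    then have "s < nat (int u - int a)" using assms by linarith
    then show ?thesis using 2 by (simp add: zbinom_def fallfact_eq_0)
  qed (simp add: zbinom_def fallfact_eq_0)
qed

text \<open>The numerator of \<open>ballot\<close> over the common denominator
  \<open>fact u * fact v\<close>, up to \<open>fact s\<close>. The ring is left open so that
  polynomials can be inserted for a degree count.\<close>

definition ballot_poly :: "nat \<Rightarrow> nat \<Rightarrow> 'a::comm_ring_1 \<Rightarrow> 'a \<Rightarrow> 'a" where
  "ballot_poly p j x y =
     fallfact x j * fallfact y (2 * p - 1 - j) - fallfact x (2 * p - 1 - j) * fallfact y j"

text \<open>With \<open>z = u + 1 - p\<close> the two lower indices become \<open>u - j\<close> and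
  \<open>u - (2 * p - 1 - j)\<close>; their complements in \<open>s\<close> are
  \<open>v - (2 * p - 1 - j)\<close> and \<open>v - j\<close>.\<close>

lemma ballot_eq_ballot_poly:
  assumes "u + v = s + 2 * p - 1" and "j < p"
  shows "ballot s (int u + 1 - int p) (p - 1 - j) =
    fact s / (fact u * fact v) * ballot_poly p j (real u) (real v)"
proof -
  have 1: "zbinom s (int u - int j) * fact u * fact v =
      fact s * fallfact (real u) j * fallfact (real v) (2 * p - 1 - j)"
    by (rule zbinom_fallfact) (use assms in simp)
  have 2: "zbinom s (int u - int (2 * p - 1 - j)) * fact u * fact v =
      fact s * fallfact (real u) (2 * p - 1 - j) * fallfact (real v) j"
    by (rule zbinom_fallfact) (use assms in simp)
  have "int u + 1 - int p + int (p - 1 - j) = int u - int j"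
    "int u + 1 - int p - int (p - 1 - j) - 1 = int u - int (2 * p - 1 - j)"
    using assms by auto
  then have "ballot s (int u + 1 - int p) (p - 1 - j) * (fact u * fact v) =
      fact s * ballot_poly p j (real u) (real v)"
    using 1 2 by (simp add: ballot_def ballot_poly_def algebra_simps)
  then show ?thesis by (simp add: field_simps)
qed

lemma poly_fallfact: "poly (fallfact q a) x = fallfact (poly q x) a"
  by (simp add: fallfact_def poly_prod of_nat_poly)

lemma degree_fallfact_le: "degree q \<le> 1 \<Longrightarrow> degree (fallfact q a) \<le> a"
proof (induction a)
  case (Suc a)
  have "degree (q - of_nat a) \<le> 1"
    using Suc.prems by (intro degree_diff_le) (auto simp: of_nat_poly)
  with Suc show ?case
    using degree_mult_le[of "fallfact q a" "q - of_nat a"] by (simp add: fallfact_def)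
qed (simp add: fallfact_def)

text \<open>\<open>ballot_poly\<close> changes sign when its arguments are exchanged, so it is an odd function of
  their difference when their sum is fixed.\<close>

lemma ballot_poly_odd_expansion:
  fixes K :: real
  assumes "j < p"
  obtains c where "\<And>x y. x + y = K \<Longrightarrow> ballot_poly p j x y = (\<Sum>a<p. (y - x) ^ (2 * a + 1) * c a)"
proof -
  \<comment> \<open>\<open>q1\<close> and \<open>q2\<close> express \<open>x\<close> and
    \<open>y\<close> through \<open>t = y - x\<close> when \<open>x + y = K\<close>.\<close>
  define q1 where "q1 = [:K / 2, - 1 / 2:]"
  define q2 where "q2 = [:K / 2, 1 / 2:]"
  define P where "P = ballot_poly p j q1 q2"
  have "degree q1 \<le> 1" "degree q2 \<le> 1" by (simp_all add: q1_def q2_def)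
  then have "degree (fallfact q1 a * fallfact q2 b) \<le> a + b" for a b
    using order_trans[OF degree_mult_le add_mono[OF degree_fallfact_le degree_fallfact_le]] by blast
  from this[of j "2 * p - 1 - j"] this[of "2 * p - 1 - j" j]
  have "degree (fallfact q1 j * fallfact q2 (2 * p - 1 - j)) \<le> 2 * p - 1"
    "degree (fallfact q1 (2 * p - 1 - j) * fallfact q2 j) \<le> 2 * p - 1"
    using assms by simp_all
  then have deg: "degree P \<le> 2 * p - 1"
    unfolding P_def ballot_poly_def by (intro degree_diff_le)
  have val: "poly P t = ballot_poly p j ((K - t) / 2) ((K + t) / 2)" for t
    by (simp add: P_def ballot_poly_def poly_fallfact q1_def q2_def field_simps)
  have neg: "poly P (- t) = - poly P t" for t
    by (simp add: val ballot_poly_def)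
  have exp: "poly P t = (\<Sum>a<p. t ^ (2 * a + 1) * coeff P (2 * a + 1))" for t
  proof -
    have s: "poly P t = (\<Sum>i<2 * p. coeff P i * t ^ i)" for t
    proof -
      have "{..degree P} \<subseteq> {..<2 * p}" using deg assms by auto
      then show ?thesis unfolding poly_altdef
        by (intro sum.mono_neutral_left) (auto simp: coeff_eq_0)
    qed
    \<comment> \<open>Subtracting the value at \<open>- t\<close> removes the even powers and
      doubles the odd ones.\<close>
    have "2 * poly P t = poly P t - poly P (- t)" by (simp add: neg)
    also have "\<dots> = (\<Sum>i<2 * p. coeff P i * (t ^ i - (- t) ^ i))"
      unfolding s by (simp add: sum_subtractf right_diff_distrib)
    also have "\<dots> = 2 * (\<Sum>a<p. t ^ (2 * a + 1) * coeff P (2 * a + 1))"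
      by (induction p) (simp_all add: algebra_simps)
    finally show ?thesis by simp
  qed
  show thesis
  proof (rule that[of "\<lambda>a. coeff P (2 * a + 1)"])
    fix x y assume "x + y = K"
    then have "(K - (y - x)) / 2 = x" "(K + (y - x)) / 2 = y" by (auto simp: field_simps)
    then show "ballot_poly p j x y = (\<Sum>a<p. (y - x) ^ (2 * a + 1) * coeff P (2 * a + 1))"
      using val[of "y - x"] exp[of "y - x"] by metis
  qed
qed

text \<open>Multiplication by the unitriangular matrix of the Newton polynomials \<open>q l\<close>
  makes the Vandermonde matrix lower triangular, since \<open>q l\<close> vanishes at
  \<open>x i\<close> for \<open>i < l\<close>.\<close>

lemma det_vandermonde:
  fixes x :: "nat \<Rightarrow> 'a::idom"
  shows "det (mat p p (\<lambda>(i, a). x i ^ a)) = (\<Prod>i<p. \<Prod>j<i. x i - x j)"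
proof -
  define V where "V = mat p p (\<lambda>(i, a). x i ^ a)"
  define q where "q l = (\<Prod>s<l. [:- x s, 1:])" for l
  define C where "C = mat p p (\<lambda>(a, l). coeff (q l) a)"
  have mon: "lead_coeff (q l) = 1" for l
    by (simp add: q_def lead_coeff_prod)
  have "degree (q l) = l" for l
    unfolding q_def by (subst degree_prod_eq_sum_degree) auto
  note dq = this
  have VC: "V * C = mat p p (\<lambda>(i, l). \<Prod>s<l. x i - x s)"
  proof (rule eq_matI)
    fix i l assume "i < dim_row (mat p p (\<lambda>(i, l). \<Prod>s<l. x i - x s))"
      "l < dim_col (mat p p (\<lambda>(i, l). \<Prod>s<l. x i - x s))"
    then have il: "i < p" "l < p" by auto
    have "(V * C) $$ (i, l) = (\<Sum>a<p. x i ^ a * coeff (q l) a)"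
      using il by (simp add: V_def C_def scalar_prod_def atLeast0LessThan)
    also have "\<dots> = poly (q l) (x i)"
      unfolding poly_altdef dq
      by (rule sum.mono_neutral_cong_right) (use il in \<open>auto simp: coeff_eq_0 dq\<close>)
    finally show "(V * C) $$ (i, l) = mat p p (\<lambda>(i, l). \<Prod>s<l. x i - x s) $$ (i, l)"
      using il by (simp add: q_def poly_prod)
  qed (auto simp: V_def C_def)
  have "det C = prod_list (diag_mat C)"
    by (rule det_upper_triangular[of _ p]) (auto simp: C_def coeff_eq_0 dq)
  also have "\<dots> = 1"
    unfolding prod_list_diag_prod using mon by (intro prod.neutral) (auto simp: C_def dq)
  finally have "det C = 1" .
  moreover have "det (V * C) = det V * det C"
    by (rule det_mult) (auto simp: V_def C_def)
  moreover have "det (V * C) = prod_list (diag_mat (V * C))"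
    by (rule det_lower_triangular[of p]) (auto simp: VC)
  moreover have "\<dots> = (\<Prod>i<p. \<Prod>j<i. x i - x j)"
    unfolding prod_list_diag_prod VC by (auto simp: atLeast0LessThan)
  ultimately show ?thesis by (simp add: V_def)
qed

lemma det_row_scale:
  fixes c :: "nat \<Rightarrow> 'a::comm_ring_1"
  shows "det (mat p p (\<lambda>(i, j). c i * f i j)) = (\<Prod>i<p. c i) * det (mat p p (\<lambda>(i, j). f i j))"
proof -
  have "(\<Prod>i = 0..<p. mat p p (\<lambda>(i, j). c i * f i j) $$ (i, \<pi> i)) =
      (\<Prod>i<p. c i) * (\<Prod>i = 0..<p. mat p p (\<lambda>(i, j). f i j) $$ (i, \<pi> i))"
    if "\<pi> permutes {0..<p}" for \<pi>
  proof -
    have "\<pi> i < p" if "i < p" for i using permutes_in_image[OF \<open>\<pi> permutes _\<close>, of i] that by auto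
    then show ?thesis by (simp add: prod.distrib[symmetric] atLeast0LessThan)
  qed
  then show ?thesis
    by (subst (1 2) det_def'[of _ p]) (auto simp: sum_distrib_left mult.left_commute intro!: sum.cong)
qed

text \<open>The Lindstroem-Gessel-Viennot determinant. Column \<open>j\<close> belongs to the
  endpoint \<open>j + 1 - p\<close>, so the endpoints increase with the column and no sign
  arises.\<close>

definition ballot_det :: "nat \<Rightarrow> nat \<Rightarrow> (nat \<Rightarrow> int) \<Rightarrow> real" where
  "ballot_det p s z = det (mat p p (\<lambda>(i, j). ballot s (z i) (p - 1 - j)))"

text \<open>All reflected terms have negative lower indices; the entries
  \<open>zbinom s (i - j)\<close> that remain form a lower unitriangular matrix.\<close>

lemma ballot_det_target: "ballot_det p s (\<lambda>i. int i + 1 - int p) = 1"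
proof -
  define A where "A = mat p p (\<lambda>(i, j). ballot s (int i + 1 - int p) (p - 1 - j))"
  have upper: "A $$ (i, j) = 0" if "i < j" "j < p" for i j
    using that by (auto simp: A_def ballot_def zbinom_def)
  have diag: "A $$ (i, i) = 1" if "i < p" for i
    using that by (auto simp: A_def ballot_def zbinom_def of_nat_diff)
  have "det A = prod_list (diag_mat A)"
    by (rule det_lower_triangular[OF upper]) (auto simp: A_def)
  also have "\<dots> = 1"
    unfolding prod_list_diag_prod by (rule prod.neutral) (use diag in \<open>auto simp: A_def\<close>)
  finally show ?thesis by (simp add: ballot_det_def A_def)
qed

text \<open>The determinant is a product up to a factor depending on \<open>s\<close> only; evaluating it at the
  target, where it is 1, determines this factor.\<close>

lemma ballot_det_eq:
  fixes u v :: "nat \<Rightarrow> nat" and p s :: nat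
  defines "Y \<equiv> \<lambda>i. real (s + 2 * p - 1) - 2 * real i"
    and "y \<equiv> \<lambda>i. real (v i) - real (u i)"
  assumes uv: "\<And>i. i < p \<Longrightarrow> u i + v i = s + 2 * p - 1"
  shows "ballot_det p s (\<lambda>i. int (u i) + 1 - int p) =
    (\<Prod>i<p. fact i * fact (s + 2 * p - 1 - i) / (fact (u i) * fact (v i)) * y i / Y i
       * (\<Prod>j<i. ((y i)\<^sup>2 - (y j)\<^sup>2) / ((Y i)\<^sup>2 - (Y j)\<^sup>2)))"
proof -
  have "\<exists>c. \<forall>x y. x + y = real (s + 2 * p - 1) \<longrightarrow>
      ballot_poly p j x y = (\<Sum>a<p. (y - x) ^ (2 * a + 1) * c a)" if "j < p" for j
    by (rule ballot_poly_odd_expansion[OF that, of "real (s + 2 * p - 1)"]) blast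
  then obtain c where c: "\<And>j x y. j < p \<Longrightarrow> x + y = real (s + 2 * p - 1) \<Longrightarrow>
      ballot_poly p j x y = (\<Sum>a<p. (y - x) ^ (2 * a + 1) * c j a)"
    by metis
  \<comment> \<open>\<open>C\<close> depends on \<open>p\<close> and \<open>s\<close> only; the
    starting points enter through \<open>W\<close>, a row-scaled Vandermonde matrix in the
    squares.\<close>
  define C where "C = mat p p (\<lambda>(a, j). c j a)"
  have fac: "ballot_det p s (\<lambda>i. int (u i) + 1 - int p) =
    (\<Prod>i<p. fact s / (fact (u i) * fact (v i)) * (real (v i) - real (u i)))
    * (\<Prod>i<p. \<Prod>j<i. (real (v i) - real (u i))\<^sup>2 - (real (v j) - real (u j))\<^sup>2) * det C"
    if uv: "\<And>i. i < p \<Longrightarrow> u i + v i = s + 2 * p - 1" for u v :: "nat \<Rightarrow> nat"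
  proof -
    define y where "y i = real (v i) - real (u i)" for i
    define w where "w i = fact s / (fact (u i) * fact (v i)) * y i" for i
    define W where "W = mat p p (\<lambda>(i, a). w i * ((y i)\<^sup>2) ^ a)"
    have "mat p p (\<lambda>(i, j). ballot s (int (u i) + 1 - int p) (p - 1 - j)) = W * C"
    proof (rule eq_matI)
      fix i j assume "i < dim_row (W * C)" "j < dim_col (W * C)"
      then have ij: "i < p" "j < p" by (auto simp: W_def C_def)
      have "ballot s (int (u i) + 1 - int p) (p - 1 - j) =
          fact s / (fact (u i) * fact (v i)) * (\<Sum>a<p. y i ^ (2 * a + 1) * c j a)"
        using uv[OF ij(1)] ij
        by (subst ballot_eq_ballot_poly[OF _ ij(2)]) (auto simp: c y_def simp flip: of_nat_add)
      also have "\<dots> = (\<Sum>a<p. w i * ((y i)\<^sup>2) ^ a * c j a)"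
        by (simp add: w_def sum_distrib_left mult_ac flip: power_mult)
      finally show "mat p p (\<lambda>(i, j). ballot s (int (u i) + 1 - int p) (p - 1 - j)) $$ (i, j) =
          (W * C) $$ (i, j)"
        using ij by (simp add: W_def C_def scalar_prod_def atLeast0LessThan)
    qed (auto simp: W_def C_def)
    moreover have "det (W * C) = det W * det C"
      by (rule det_mult) (auto simp: W_def C_def)
    ultimately show ?thesis
      unfolding ballot_det_def W_def det_row_scale det_vandermonde w_def y_def by simp
  qed
  \<comment> \<open>The factor in front of \<open>det C\<close> for \<open>u i = i\<close>, that is,
    for walks starting at the target.\<close>
  define F where "F = (\<Prod>i<p. fact s / (fact i * fact (s + 2 * p - 1 - i)) * Y i)
    * (\<Prod>i<p. \<Prod>j<i. (Y i)\<^sup>2 - (Y j)\<^sup>2)"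
  have "1 = F * det C"
  proof -
    have "real (s + 2 * p - 1 - i) - real i = Y i" if "i < p" for i
      using that by (simp add: Y_def of_nat_diff)
    then show ?thesis
      using fac[of "\<lambda>i. i" "\<lambda>i. s + 2 * p - 1 - i"] by (simp add: F_def ballot_det_target)
  qed
  \<comment> \<open>The value 1 at the target makes \<open>F\<close> nonzero without inspecting its
    factors.\<close>
  then have "F \<noteq> 0" by auto
  with \<open>1 = F * det C\<close> have F: "det C = 1 / F" by (metis nonzero_mult_div_cancel_left)
  have "ballot_det p s (\<lambda>i. int (u i) + 1 - int p) =
    (\<Prod>i<p. fact s / (fact (u i) * fact (v i)) * y i) * (\<Prod>i<p. \<Prod>j<i. (y i)\<^sup>2 - (y j)\<^sup>2) / F"
    using fac[of u v, OF uv] by (simp add: F y_def)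
  then show ?thesis
    unfolding F_def by (simp add: prod.distrib prod_dividef mult_ac)
qed

section \<open>Nonintersecting walks\<close>

text \<open>Here \<open>s\<close> counts the steps that remain after this one, so the wall is tested
  at the new state.\<close>

definition steps :: "nat \<Rightarrow> nat \<Rightarrow> int list \<Rightarrow> int list set" where
  "steps p s z = {z'. length z' = p \<and> sorted_wrt (<) z' \<and>
     (\<forall>i<p. (z' ! i = z ! i \<or> z' ! i = z ! i - 1) \<and> 2 * z' ! i \<le> int s)}"

definition target :: "nat \<Rightarrow> int list" where
  "target p = map (\<lambda>i. int i + 1 - int p) [0..<p]"

fun walks :: "nat \<Rightarrow> nat \<Rightarrow> int list \<Rightarrow> int list list set" where
  "walks p 0 z = (if z = target p then {[z]} else {})"
| "walks p (Suc s) z = (\<Union>z'\<in>steps p s z. (#) z ` walks p s z')"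

lemma ballot_det_expand:
  "ballot_det p s z = (\<Sum>\<pi> | \<pi> permutes {0..<p}. signof \<pi> * (\<Prod>i<p. ballot s (z i) (p - 1 - \<pi> i)))"
proof -
  have "(\<Prod>i = 0..<p. mat p p (\<lambda>(i, j). ballot s (z i) (p - 1 - j)) $$ (i, \<pi> i)) =
      (\<Prod>i<p. ballot s (z i) (p - 1 - \<pi> i))" if "\<pi> permutes {0..<p}" for \<pi>
  proof -
    have "\<pi> i < p" if "i < p" for i using permutes_in_image[OF \<open>\<pi> permutes _\<close>, of i] that by auto
    then show ?thesis by (simp add: atLeast0LessThan)
  qed
  then show ?thesis
    unfolding ballot_det_def by (subst det_def'[of _ p]) (auto intro!: sum.cong)
qed

lemma ballot_det_zero_row:
  assumes "i < p" and "\<And>l. l < p \<Longrightarrow> ballot s (z i) l = 0"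
  shows "ballot_det p s z = 0"
proof -
  have "(\<Prod>i<p. ballot s (z i) (p - 1 - \<pi> i)) = 0" for \<pi> :: "nat \<Rightarrow> nat"
    using assms by (intro prod_zero bexI[of _ i]) auto
  then show ?thesis unfolding ballot_det_expand by (simp only: mult_zero_right sum.neutral_const)
qed

text \<open>Multilinearity in the rows, carried out on the Leibniz expansion.\<close>

lemma ballot_det_Suc:
  "ballot_det p (Suc s) z = (\<Sum>e\<in>{..<p} \<rightarrow>\<^sub>E {0, 1}. ballot_det p s (\<lambda>i. z i - e i))"
proof -
  have "(\<Prod>i<p. \<Sum>d\<in>{0, 1}. ballot s (z i - d) (p - 1 - \<pi> i)) =
      (\<Sum>e\<in>{..<p} \<rightarrow>\<^sub>E {0, 1}. \<Prod>i<p. ballot s (z i - e i) (p - 1 - \<pi> i))" for \<pi> :: "nat \<Rightarrow> nat"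
    by (rule prod_sum_PiE) auto
  then have *: "(\<Prod>i<p. ballot (Suc s) (z i) (p - 1 - \<pi> i)) =
      (\<Sum>e\<in>{..<p} \<rightarrow>\<^sub>E {0, 1}. \<Prod>i<p. ballot s (z i - e i) (p - 1 - \<pi> i))" for \<pi> :: "nat \<Rightarrow> nat"
    by (simp add: ballot_Suc)
  show ?thesis
    unfolding ballot_det_expand * sum_distrib_left by (rule sum.swap)
qed

text \<open>The interval has exactly \<open>p\<close> elements, so the list exhausts it.\<close>

lemma target_unique:
  assumes "length z = p" and "sorted_wrt (<) z" and "set z \<subseteq> {1 - int p..0}"
  shows "z = target p"
proof -
  have t: "sorted_wrt (<) (target p)" "set (target p) = {1 - int p..0}"
  proof -
    show "sorted_wrt (<) (target p)" by (auto simp: target_def sorted_wrt_iff_nth_less)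
    have "x \<in> (\<lambda>i. int i + 1 - int p) ` {0..<p}" if "x \<in> {1 - int p..0}" for x
      using that by (intro image_eqI[of _ _ "nat (x + int p - 1)"]) auto
    then show "set (target p) = {1 - int p..0}" by (auto simp: target_def)
  qed
  have "set z = {1 - int p..0}"
    using assms by (intro card_subset_eq) (auto simp: strict_sorted_iff distinct_card)
  then show ?thesis
    using assms t by (metis strict_sorted_equal)
qed

text \<open>The determinant satisfies the recursion of the walks: if a choice of one step in every
  coordinate violates the strict order or the wall, its determinant has two equal rows or a zero
  row.\<close>

lemma card_walks:
  assumes "length z = p" and "sorted_wrt (<) z" and "\<And>i. i < p \<Longrightarrow> 2 * z ! i \<le> int s"
  shows "finite (walks p s z) \<and> real (card (walks p s z)) = ballot_det p s (\<lambda>i. z ! i)"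
  using assms
proof (induction s arbitrary: z)
  case 0
  show ?case
  proof (cases "z = target p")
    case True
    have "ballot_det p 0 (\<lambda>i. z ! i) = ballot_det p 0 (\<lambda>i. int i + 1 - int p)"
      unfolding ballot_det_def using True
      by (intro arg_cong[where f = det] eq_matI) (auto simp: target_def)
    then show ?thesis using True by (simp add: ballot_det_target)
  next
    case False
    then obtain i where i: "i < p" "z ! i \<notin> {1 - int p..0}"
      using target_unique[OF 0(1,2)] 0(1) by (metis in_set_conv_nth subsetI)
    \<comment> \<open>By the wall this entry is at most 0, so it lies below every endpoint and its
      row vanishes.\<close>
    have "ballot_det p 0 (\<lambda>i. z ! i) = 0"
      using i 0(3)[OF i(1)] by (intro ballot_det_zero_row[of i]) (auto simp: ballot_0)
    then show ?thesis using False by simp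
  qed
next
  case (Suc s)
  define E where "E = {..<p} \<rightarrow>\<^sub>E {0, 1 :: int}"
  define g where "g e = map (\<lambda>i. z ! i - e i) [0..<p]" for e
  have fin: "finite E" by (auto simp: E_def intro: finite_PiE)
  have inj: "inj_on g E"
  proof (rule inj_onI)
    fix e e' assume "e \<in> E" "e' \<in> E" "g e = g e'"
    then show "e = e'"
      by (intro PiE_ext[of e _ _ e']) (auto simp: E_def g_def)
  qed
  have sub: "steps p s z \<subseteq> g ` E"
  proof
    fix z' assume z': "z' \<in> steps p s z"
    define e where "e = (\<lambda>i\<in>{..<p}. z ! i - z' ! i)"
    have "e \<in> E" using z' by (auto simp: e_def E_def steps_def)
    moreover have "z' = g e" using z' by (auto simp: e_def g_def steps_def intro!: nth_equalityI)
    ultimately show "z' \<in> g ` E" by blast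
  qed
  have zero: "ballot_det p s (\<lambda>i. z' ! i) = 0" if bad: "z' \<in> g ` E - steps p s z" for z'
  proof -
    obtain e where e: "e \<in> E" "z' = g e" using bad by blast
    have nth: "z' ! i = z ! i \<or> z' ! i = z ! i - 1" if "i < p" for i
      using e that by (auto simp: g_def E_def PiE_iff)
    have len: "length z' = p" using e by (simp add: g_def)
    from bad len nth consider i where "i < p" "2 * z' ! i > int s" | "\<not> sorted_wrt (<) z'"
      by (force simp: steps_def)
    then show ?thesis
    proof cases
      case 1
      \<comment> \<open>The wall held with one more step remaining, so it is overshot by the least
        possible amount, where \<open>ballot\<close> vanishes.\<close>
      then have "2 * z' ! i = int s + 1" using Suc.prems(3)[of i] nth[of i] by auto
      then show ?thesis using 1 by (intro ballot_det_zero_row[of i]) (auto simp: ballot_wall)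
    next
      case 2
      then obtain i j where ij: "i < j" "j < p" "\<not> z' ! i < z' ! j"
        using len by (auto simp: sorted_wrt_iff_nth_less)
      moreover have "z ! i < z ! j"
        using ij Suc.prems(1,2) by (auto simp: sorted_wrt_iff_nth_less)
      \<comment> \<open>Strictly increasing integers that drop by at most 1 can meet but not cross
        in one step.\<close>
      ultimately have "z' ! i = z' ! j" using nth[of i] nth[of j] by auto
      then show ?thesis
        unfolding ballot_det_def using ij
        by (intro det_identical_rows[of _ p i j]) (auto intro!: eq_vecI)
    qed
  qed
  have IH: "finite (walks p s z') \<and> real (card (walks p s z')) = ballot_det p s (\<lambda>i. z' ! i)"
    if "z' \<in> steps p s z" for z'
    using that by (intro Suc.IH) (auto simp: steps_def)
  have fs: "finite (steps p s z)" using sub fin finite_subset by blast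
  have hd: "hd w = z'" if "w \<in> walks p s z'" for w z'
    using that by (cases s) (auto split: if_splits)
  have "card (walks p (Suc s) z) = (\<Sum>z'\<in>steps p s z. card ((#) z ` walks p s z'))"
    unfolding walks.simps using fs IH by (intro card_UN_disjoint) (auto dest: hd)
  also have "\<dots> = (\<Sum>z'\<in>steps p s z. card (walks p s z'))"
    by (simp add: card_image)
  finally have "real (card (walks p (Suc s) z)) = (\<Sum>z'\<in>steps p s z. ballot_det p s (\<lambda>i. z' ! i))"
    using IH by simp
  also have "\<dots> = (\<Sum>z'\<in>g ` E. ballot_det p s (\<lambda>i. z' ! i))"
    using sub fin zero by (intro sum.mono_neutral_left) auto
  also have "\<dots> = (\<Sum>e\<in>E. ballot_det p s (\<lambda>i. g e ! i))"
    by (rule sum.reindex[OF inj, unfolded o_def])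
  also have "\<dots> = (\<Sum>e\<in>E. ballot_det p s (\<lambda>i. z ! i - e i))"
    unfolding ballot_det_def
    by (intro sum.cong refl arg_cong[where f = det] eq_matI) (auto simp: g_def)
  also have "\<dots> = ballot_det p (Suc s) (\<lambda>i. z ! i)"
    by (simp add: ballot_det_Suc E_def)
  finally show ?case using fs IH by auto
qed

text \<open>Trades the recursion for conditions on the state at each time, the form in which walks
  are compared with fillings.\<close>

lemma walks_iff:
  "w \<in> walks p s z \<longleftrightarrow> length w = Suc s \<and> w ! 0 = z \<and> w ! s = target p \<and>
     (\<forall>t<s. w ! Suc t \<in> steps p (s - Suc t) (w ! t))"
proof (induction s arbitrary: w z)
  case 0
  then show ?case by (auto simp: length_Suc_conv)
next
  case (Suc s)
  show ?case
  proof (cases w)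
    case (Cons a w')
    have "w \<in> walks p (Suc s) z \<longleftrightarrow> a = z \<and> (\<exists>z'\<in>steps p s z. w' \<in> walks p s z')"
      by (auto simp: Cons)
    also have "\<dots> \<longleftrightarrow> a = z \<and> w' ! 0 \<in> steps p s z \<and> length w' = Suc s \<and> w' ! s = target p \<and>
        (\<forall>t<s. w' ! Suc t \<in> steps p (s - Suc t) (w' ! t))"
      unfolding Suc.IH by auto
    finally show ?thesis
      unfolding Cons All_less_Suc2 by auto
  qed auto
qed

section \<open>Maximal fillings and walks\<close>

lemma strict_mono_on_gap:
  fixes r :: "nat \<Rightarrow> nat"
  assumes "strict_mono_on {1..k} r" and "1 \<le> a" and "a \<le> b" and "b \<le> k"
  shows "r a + (b - a) \<le> r b"
  using assms(3,4)
proof (induction b rule: dec_induct)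
  case (step b)
  have "r b < r (Suc b)" using assms step by (intro strict_mono_onD[OF assms(1)]) auto
  with step show ?case by simp
qed simp

text \<open>For \<open>p < m\<close> and \<open>m \<le> n\<close> this is
  \<open>Rbar m n (m - p)\<close>; with \<open>p = k - 1\<close> it has the larger staircase, cut
  off along an antidiagonal.\<close>

definition region :: "nat \<Rightarrow> nat \<Rightarrow> nat \<Rightarrow> box set" where
  "region m n p = {(i, j). 1 \<le> i \<and> i \<le> m \<and> 1 \<le> j \<and> j \<le> n \<and> i + j \<le> n + p}"

lemma region_iff: "(i, j) \<in> region m n p \<longleftrightarrow> 1 \<le> i \<and> i \<le> m \<and> 1 \<le> j \<and> j \<le> n \<and> i + j \<le> n + p"
  by (simp add: region_def)

lemma finite_region: "finite (region m n p)"
  by (rule finite_subset[of _ "{..m} \<times> {..n}"]) (auto simp: region_def)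

text \<open>The box \<open>(r k, c k)\<close> of a chain is filled with 1, so it lies in the region, and with it the
  whole rectangle spanned by the chain.\<close>

lemma contains_I_region:
  "contains_I (region m n p) k F \<longleftrightarrow>
    (\<exists>r c. strict_mono_on {1..k} r \<and> strict_mono_on {1..k} c \<and>
      (\<forall>i\<in>{1..k}. (r i, c i) \<in> region m n p \<and> F (r i, c i) = 1))"
proof -
  have "(r i, c j) \<in> region m n p"
    if r: "strict_mono_on {1..k} r" and c: "strict_mono_on {1..k} c"
      and R: "\<forall>i\<in>{1..k}. (r i, c i) \<in> region m n p" and ij: "i \<in> {1..k}" "j \<in> {1..k}" for r c i j
  proof -
    have "r i \<le> r k" "c j \<le> c k"
      using strict_mono_on_gap[OF r, of i k] strict_mono_on_gap[OF c, of j k] ij by auto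
    moreover have "(r k, c k) \<in> region m n p" "(r i, c i) \<in> region m n p" "(r j, c j) \<in> region m n p"
      using R ij by auto
    ultimately show ?thesis by (auto simp: region_iff)
  qed
  then show ?thesis unfolding contains_I_def by blast
qed

text \<open>The diagonals \<open>j - i = t + p - m\<close> for \<open>0 \<le> t \<le> duration\<close> form the band; each of them meets the
  region in at least \<open>p\<close> boxes, and the boxes outside the band are in no chain of length \<open>p + 1\<close>.
  The position \<open>x\<close> on a diagonal stands for the row \<open>x + p\<close>.\<close>

locale band =
  fixes m n p :: nat
  assumes p_pos: "1 \<le> p" and p_less_m: "p < m" and m_le_n: "m \<le> n"
begin

abbreviation R :: "box set" where "R \<equiv> region m n p"

definition duration :: nat where "duration = m + n - 2 * p"

definition in_band :: "box \<Rightarrow> bool" where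
  "in_band b \<longleftrightarrow> fst b + p \<le> snd b + m \<and> snd b + p \<le> fst b + n"

text \<open>The subtraction is genuine for boxes of the band; elsewhere it may be truncated.\<close>

definition time :: "box \<Rightarrow> nat" where
  "time b = snd b + m - (fst b + p)"

definition positions :: "(box \<Rightarrow> nat) \<Rightarrow> nat \<Rightarrow> int set" where
  "positions F t = {x. \<exists>i j. (i, j) \<in> R \<and> F (i, j) = 1 \<and> x = int i - int p \<and>
     int j = x + int t + 2 * int p - int m}"

text \<open>The diagonal at time 0 has exactly \<open>p\<close> boxes, in the last \<open>p\<close>
  rows, so its state is forced.\<close>

definition start :: "int list" where
  "start = map (\<lambda>i. int m - 2 * int p + int i + 1) [0..<p]"

lemma finite_positions: "finite (positions F t)"
  by (rule finite_subset[of _ "(\<lambda>b. int (fst b) - int p) ` R"])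
    (force simp: positions_def finite_region)+

lemma positions_box:
  assumes "(i, j) \<in> R" and "in_band (i, j)"
  shows "int i - int p \<in> positions F (time (i, j)) \<longleftrightarrow> F (i, j) = 1"
proof
  assume "int i - int p \<in> positions F (time (i, j))"
  then obtain i' j' where "F (i', j') = 1" "int i - int p = int i' - int p"
    "int j' = int i - int p + int (time (i, j)) + 2 * int p - int m"
    unfolding positions_def by blast
  moreover then have "i' = i" "j' = j"
    using assms by (auto simp: time_def in_band_def of_nat_diff)
  ultimately show "F (i, j) = 1" by simp
next
  assume "F (i, j) = 1"
  then show "int i - int p \<in> positions F (time (i, j))"
    unfolding positions_def using assms by (auto simp: time_def in_band_def of_nat_diff)
qed

lemma time_le: "in_band b \<Longrightarrow> time b \<le> duration"
  by (auto simp: in_band_def time_def duration_def)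

text \<open>Row and column are \<open>x q\<close> and \<open>x q + \<tau> q\<close> up to constants,
  so the hypotheses describe a strictly south-east chain of \<open>p + 1\<close> ones.\<close>

lemma no_increasing_positions:
  assumes F: "F \<in> avoiding_fillings R (Suc p)"
    and x: "\<And>q. q \<le> p \<Longrightarrow> x q \<in> positions F (\<tau> q)"
    and rows: "\<And>q q'. q < q' \<Longrightarrow> q' \<le> p \<Longrightarrow> x q < x q'"
    and cols: "\<And>q q'. q < q' \<Longrightarrow> q' \<le> p \<Longrightarrow> x q + int (\<tau> q) < x q' + int (\<tau> q')"
  shows False
proof -
  have "\<exists>i j. (i, j) \<in> R \<and> F (i, j) = 1 \<and> int i = x q + int p \<and>
      int j = x q + int (\<tau> q) + 2 * int p - int m" if "q \<le> p" for q
    using x[OF that] unfolding positions_def by force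
  then obtain r c where rc: "\<And>q. q \<le> p \<Longrightarrow> (r q, c q) \<in> R \<and> F (r q, c q) = 1 \<and>
      int (r q) = x q + int p \<and> int (c q) = x q + int (\<tau> q) + 2 * int p - int m"
    by metis
  have "strict_mono_on {1..Suc p} (\<lambda>q. r (q - 1))" "strict_mono_on {1..Suc p} (\<lambda>q. c (q - 1))"
  proof (safe intro!: strict_mono_onI)
    fix a b assume ab: "a \<in> {1..Suc p}" "b \<in> {1..Suc p}" "a < b"
    then have "a - 1 < b - 1" "b - 1 \<le> p" "a - 1 \<le> p" by auto
    then show "r (a - 1) < r (b - 1)" "c (a - 1) < c (b - 1)"
      using rows[of "a - 1" "b - 1"] cols[of "a - 1" "b - 1"] rc[of "a - 1"] rc[of "b - 1"] by linarith+
  qed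
  moreover have "\<forall>i\<in>{1..Suc p}. (r (i - 1), c (i - 1)) \<in> R \<and> F (r (i - 1), c (i - 1)) = 1"
    using rc by auto
  ultimately have "contains_I R (Suc p) F"
    unfolding contains_I_region by blast
  then show False using F by (simp add: avoiding_fillings_def)
qed

text \<open>The ones of a single diagonal, sorted by row, form a chain.\<close>

lemma card_positions_le:
  assumes "F \<in> avoiding_fillings R (Suc p)"
  shows "card (positions F t) \<le> p"
proof (rule ccontr)
  assume "\<not> card (positions F t) \<le> p"
  then have len: "p < length (sorted_list_of_set (positions F t))" by simp
  show False
  proof (rule no_increasing_positions[OF assms])
    fix q assume "q \<le> p"
    then show "sorted_list_of_set (positions F t) ! q \<in> positions F t"
      using len nth_mem[of q "sorted_list_of_set (positions F t)"] finite_positions by simp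
  next
    fix q q' assume "q < q'" "q' \<le> p"
    then show "sorted_list_of_set (positions F t) ! q < sorted_list_of_set (positions F t) ! q'"
      using len by (intro sorted_wrt_nth_less[OF strict_sorted_list_of_set]) auto
    then show "sorted_list_of_set (positions F t) ! q + int t
        < sorted_list_of_set (positions F t) ! q' + int t" by simp
  qed
qed

text \<open>The diagonals partition the band, and on a diagonal a box is determined by its
  row.\<close>

lemma num_ones_split:
  "num_ones R F = (\<Sum>t\<le>duration. card (positions F t)) + card {b \<in> R. \<not> in_band b \<and> F b = 1}"
proof -
  let ?A = "\<lambda>t. {b \<in> R. in_band b \<and> F b = 1 \<and> time b = t}"
  have "bij_betw (\<lambda>b. int (fst b) - int p) (?A t) (positions F t)" if "t \<le> duration" for t
  proof (rule bij_betw_imageI)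
    show "inj_on (\<lambda>b. int (fst b) - int p) (?A t)"
      by (auto simp: inj_on_def in_band_def time_def)
    show "(\<lambda>b. int (fst b) - int p) ` ?A t = positions F t"
    proof (intro equalityI subsetI)
      fix x assume "x \<in> (\<lambda>b. int (fst b) - int p) ` ?A t"
      then obtain i j where "(i, j) \<in> ?A t" "x = int i - int p" by auto
      then show "x \<in> positions F t" using positions_box[of i j F] by auto
    next
      fix x assume "x \<in> positions F t"
      then obtain i j where ij: "(i, j) \<in> R" "F (i, j) = 1" "x = int i - int p"
        "int j = x + int t + 2 * int p - int m" unfolding positions_def by blast
      then have "in_band (i, j)" "time (i, j) = t"
        using that p_less_m m_le_n by (auto simp: in_band_def time_def duration_def)
      with ij show "x \<in> (\<lambda>b. int (fst b) - int p) ` ?A t"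
        by (intro image_eqI[of _ _ "(i, j)"]) auto
    qed
  qed
  then have c: "card (positions F t) = card (?A t)" if "t \<le> duration" for t
    using that bij_betw_same_card by fastforce
  have "{b \<in> R. F b = 1} = (\<Union>t\<in>{..duration}. ?A t) \<union> {b \<in> R. \<not> in_band b \<and> F b = 1}"
    using time_le by auto
  then have "num_ones R F = card (\<Union>t\<in>{..duration}. ?A t) + card {b \<in> R. \<not> in_band b \<and> F b = 1}"
    unfolding num_ones_def by (simp only:) (rule card_Un_disjoint, auto simp: finite_region)
  also have "card (\<Union>t\<in>{..duration}. ?A t) = (\<Sum>t\<le>duration. card (?A t))"
    by (rule card_UN_disjoint) (auto simp: finite_region)
  finally show ?thesis by (simp add: c)
qed

definition hook_filling :: "box \<Rightarrow> nat" where
  "hook_filling = (\<lambda>b\<in>R. if fst b \<le> p \<or> snd b \<le> p then 1 else 0)"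

text \<open>The last box of a chain of length \<open>p + 1\<close> has row and column greater than
  \<open>p\<close>, where the filling is 0.\<close>

lemma hook_filling_avoiding: "hook_filling \<in> avoiding_fillings R (Suc p)"
proof -
  have "\<not> contains_I R (Suc p) hook_filling"
  proof
    assume "contains_I R (Suc p) hook_filling"
    then obtain r c where r: "strict_mono_on {1..Suc p} r" and c: "strict_mono_on {1..Suc p} c"
      and R: "\<forall>i\<in>{1..Suc p}. (r i, c i) \<in> R \<and> hook_filling (r i, c i) = 1"
      unfolding contains_I_region by blast
    have "r 1 + p \<le> r (Suc p)" "c 1 + p \<le> c (Suc p)"
      using strict_mono_on_gap[OF r, of 1 "Suc p"] strict_mono_on_gap[OF c, of 1 "Suc p"] by auto
    moreover have "1 \<le> r 1" "1 \<le> c 1" using R by (auto simp: region_iff)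
    moreover have "r (Suc p) \<le> p \<or> c (Suc p) \<le> p"
      using R by (auto simp: hook_filling_def split: if_splits)
    ultimately show False by linarith
  qed
  then show ?thesis by (auto simp: avoiding_fillings_def fillings_def hook_filling_def)
qed

lemma hook_filling_outside: "b \<in> R \<Longrightarrow> \<not> in_band b \<Longrightarrow> hook_filling b = 1"
  by (cases b) (auto simp: hook_filling_def in_band_def region_iff)

lemma card_positions_hook_filling:
  assumes "t \<le> duration"
  shows "card (positions hook_filling t) = p"
proof (rule antisym)
  show "card (positions hook_filling t) \<le> p"
    by (rule card_positions_le[OF hook_filling_avoiding])
  \<comment> \<open>The diagonal starts at \<open>(1 + a, 1 + b)\<close>. By truncation one of
    \<open>a\<close>, \<open>b\<close> is 0, so its first \<open>p\<close> boxes lie in the first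
    \<open>p\<close> rows or columns.\<close>
  define a where "a = m - p - t"
  define b where "b = t + p - m"
  have "(\<lambda>s. int s + int a - int p) ` {1..p} \<subseteq> positions hook_filling t"
  proof safe
    fix s assume s: "s \<in> {1..p}"
    have "(s + a, s + b) \<in> R"
      using s assms p_less_m m_le_n unfolding region_iff a_def b_def duration_def atLeastAtMost_iff
      by (intro conjI) linarith+
    moreover then have "hook_filling (s + a, s + b) = 1"
      using s by (auto simp: hook_filling_def a_def b_def)
    moreover have "int (s + b) = int (s + a) - int p + int t + 2 * int p - int m"
      using p_less_m by (auto simp: a_def b_def)
    ultimately show "int s + int a - int p \<in> positions hook_filling t"
      unfolding positions_def
      by (intro CollectI exI[of _ "s + a"] exI[of _ "s + b"]) auto
  qed
  then have "card ((\<lambda>s. int s + int a - int p) ` {1..p}) \<le> card (positions hook_filling t)"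
    by (intro card_mono finite_positions)
  then show "p \<le> card (positions hook_filling t)"
    by (subst (asm) card_image) (auto simp: inj_on_def)
qed

text \<open>The bounds for the separate diagonals and for the boxes outside the band are attained
  together by \<open>hook_filling\<close>, so a maximal filling attains each of them.\<close>

lemma maximal_fillings_iff:
  "F \<in> maximal_fillings R (Suc p) \<longleftrightarrow> F \<in> avoiding_fillings R (Suc p) \<and>
    (\<forall>b\<in>R. \<not> in_band b \<longrightarrow> F b = 1) \<and> (\<forall>t\<le>duration. card (positions F t) = p)"
proof -
  define out where "out = {b \<in> R. \<not> in_band b}"
  define top where "top = (\<Sum>t\<le>duration. p) + card out"
  have fin: "finite out" by (simp add: out_def finite_region)
  have le1: "(\<Sum>t\<le>duration. card (positions F t)) \<le> (\<Sum>t\<le>duration. p)"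
    if "F \<in> avoiding_fillings R (Suc p)" for F
    by (rule sum_mono) (rule card_positions_le[OF that])
  have le2: "card {b \<in> R. \<not> in_band b \<and> F b = 1} \<le> card out" for F :: "box \<Rightarrow> nat"
    by (rule card_mono[OF fin]) (auto simp: out_def)
  have eq: "num_ones R F = top \<longleftrightarrow>
      (\<forall>b\<in>R. \<not> in_band b \<longrightarrow> F b = 1) \<and> (\<forall>t\<le>duration. card (positions F t) = p)"
    if F: "F \<in> avoiding_fillings R (Suc p)" for F
  proof
    assume "num_ones R F = top"
    then have e: "(\<Sum>t\<le>duration. card (positions F t)) = (\<Sum>t\<le>duration. p)"
      "card {b \<in> R. \<not> in_band b \<and> F b = 1} = card out"
      using le1[OF F] le2[of F] unfolding num_ones_split top_def by linarith+
    have "{b \<in> R. \<not> in_band b \<and> F b = 1} = out"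
      by (rule card_subset_eq[OF fin _ e(2)]) (auto simp: out_def)
    moreover have "card (positions F t) = p" if "t \<le> duration" for t
    proof (rule ccontr)
      assume "card (positions F t) \<noteq> p"
      then have "(\<Sum>t\<le>duration. card (positions F t)) < (\<Sum>t\<le>duration. p)"
        using that card_positions_le[OF F]
        by (intro sum_strict_mono_ex1) (auto intro!: bexI[of _ t] simp: order_less_le)
      with e(1) show False by simp
    qed
    ultimately show "(\<forall>b\<in>R. \<not> in_band b \<longrightarrow> F b = 1) \<and> (\<forall>t\<le>duration. card (positions F t) = p)"
      by (auto simp: out_def)
  next
    assume "(\<forall>b\<in>R. \<not> in_band b \<longrightarrow> F b = 1) \<and> (\<forall>t\<le>duration. card (positions F t) = p)"
    moreover then have "{b \<in> R. \<not> in_band b \<and> F b = 1} = out" by (auto simp: out_def)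
    ultimately show "num_ones R F = top" by (simp add: num_ones_split top_def)
  qed
  have le: "num_ones R F \<le> top" if "F \<in> avoiding_fillings R (Suc p)" for F
    unfolding num_ones_split top_def using le1[OF that] le2 by (rule add_mono)
  have "num_ones R hook_filling = top"
    unfolding eq[OF hook_filling_avoiding]
    using hook_filling_outside card_positions_hook_filling by blast
  then have "F \<in> maximal_fillings R (Suc p) \<longleftrightarrow>
      F \<in> avoiding_fillings R (Suc p) \<and> num_ones R F = top"
    unfolding maximal_fillings_def using le hook_filling_avoiding by (auto intro: antisym)
  then show ?thesis using eq by blast
qed

section \<open>The bijection between walks and maximal fillings\<close>

definition walk_filling :: "int list list \<Rightarrow> box \<Rightarrow> nat" where
  "walk_filling w = (\<lambda>b\<in>R. if in_band b \<and> int (fst b) - int p \<notin> set (w ! time b) then 0 else 1)"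

lemma steps_walk:
  assumes "w \<in> walks p duration start" and "t < duration"
  shows "w ! Suc t \<in> steps p (duration - Suc t) (w ! t)"
  using assms by (auto simp: walks_iff)

lemma length_walk:
  assumes "w \<in> walks p duration start" and "t \<le> duration"
  shows "length (w ! t) = p"
  using assms steps_walk[OF assms(1), of "t - 1"]
  by (cases t) (auto simp: walks_iff start_def steps_def)

lemma sorted_walk:
  assumes "w \<in> walks p duration start" and "t \<le> duration"
  shows "sorted_wrt (<) (w ! t)"
  using assms steps_walk[OF assms(1), of "t - 1"]
  by (cases t) (auto simp: walks_iff start_def steps_def sorted_wrt_iff_nth_less)

lemma wall_walk:
  assumes "w \<in> walks p duration start" and "t \<le> duration" and "q < p"
  shows "2 * w ! t ! q \<le> int duration - int t"
proof (cases t)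
  case 0
  then show ?thesis using assms p_less_m m_le_n
    by (auto simp: walks_iff start_def duration_def of_nat_diff)
next
  case (Suc t')
  then show ?thesis using assms steps_walk[OF assms(1), of t'] by (auto simp: steps_def of_nat_diff)
qed

text \<open>Entries change by 0 or -1, so the row weakly decreases while the column,
  \<open>x + t\<close> up to a constant, weakly increases.\<close>

lemma walk_monotone:
  assumes w: "w \<in> walks p duration start" and "q < p" and "t \<le> t'" and "t' \<le> duration"
  shows "w ! t' ! q \<le> w ! t ! q \<and> w ! t ! q + int t \<le> w ! t' ! q + int t'"
  using assms(3,4)
proof (induction t' rule: dec_induct)
  case (step t')
  have "w ! Suc t' ! q = w ! t' ! q \<or> w ! Suc t' ! q = w ! t' ! q - 1"
    using steps_walk[OF w, of t'] step assms(2) by (auto simp: steps_def)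
  with step show ?case by auto
qed simp

text \<open>The point is that a walk stays inside the region, so that none of its entries is
  lost.\<close>

lemma positions_walk_filling:
  assumes w: "w \<in> walks p duration start" and t: "t \<le> duration"
  shows "positions (walk_filling w) t = set (w ! t)"
proof (intro equalityI subsetI)
  fix x assume "x \<in> positions (walk_filling w) t"
  then obtain i j where ij: "(i, j) \<in> R" "walk_filling w (i, j) = 1" "x = int i - int p"
    "int j = x + int t + 2 * int p - int m" unfolding positions_def by blast
  then have "in_band (i, j)" "time (i, j) = t"
    using t p_less_m m_le_n by (auto simp: in_band_def time_def duration_def)
  with ij show "x \<in> set (w ! t)" by (auto simp: walk_filling_def split: if_splits)
next
  fix x assume "x \<in> set (w ! t)"
  then obtain q where q: "q < p" "x = w ! t ! q"
    using length_walk[OF w t] by (metis in_set_conv_nth)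
  have "w ! 0 ! q = int m - 2 * int p + int q + 1" "w ! duration ! q = int q + 1 - int p"
    using w q by (auto simp: walks_iff start_def target_def)
  \<comment> \<open>Monotonicity between \<open>start\<close> and \<open>target\<close> confines
    rows and columns to the rectangle; the wall inequality is the staircase condition
    \<open>i + j \<le> n + p\<close>.\<close>
  then have b: "int q + 1 - int p \<le> x" "x \<le> int m - 2 * int p + int q + 1"
    "int m - 2 * int p + int q + 1 \<le> x + int t"
    "x + int t \<le> int q + 1 - int p + int duration" "2 * x \<le> int duration - int t"
    using walk_monotone[OF w q(1), of 0 t] walk_monotone[OF w q(1), of t duration]
      wall_walk[OF w t q(1)] t q(2) by auto
  define i where "i = nat (x + int p)"
  define j where "j = nat (x + int t + 2 * int p - int m)"
  have i: "int i = x + int p" and j: "int j = x + int t + 2 * int p - int m"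
    using b q(1) by (auto simp: i_def j_def)
  have "int duration = int m + int n - 2 * int p"
    using p_less_m m_le_n by (simp add: duration_def of_nat_diff)
  then have R: "(i, j) \<in> R"
    unfolding region_iff using b q(1) i j by (intro conjI) linarith+
  have "in_band (i, j)" "time (i, j) = t"
    using t i j p_less_m m_le_n by (auto simp: in_band_def time_def duration_def)
  then have "walk_filling w (i, j) = 1"
    using R i \<open>x \<in> set (w ! t)\<close> by (simp add: walk_filling_def)
  then show "x \<in> positions (walk_filling w) t"
    unfolding positions_def using R i j by (intro CollectI exI[of _ i] exI[of _ j]) simp
qed

text \<open>The box has \<open>s - 1\<close> predecessors and \<open>Suc p - s\<close> successors,
  so both coordinates are at least \<open>s\<close>, the row is at most
  \<open>m - (Suc p - s)\<close> and the column at most \<open>n - (Suc p - s)\<close>.\<close>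

lemma chain_in_band:
  assumes "strict_mono_on {1..Suc p} r" and "strict_mono_on {1..Suc p} c"
    and "\<forall>s\<in>{1..Suc p}. (r s, c s) \<in> R" and "s \<in> {1..Suc p}"
  shows "in_band (r s, c s)"
proof -
  have "r 1 + (s - 1) \<le> r s" "c 1 + (s - 1) \<le> c s"
    "r s + (Suc p - s) \<le> r (Suc p)" "c s + (Suc p - s) \<le> c (Suc p)"
    using assms(4) by (auto intro!: strict_mono_on_gap[OF assms(1)] strict_mono_on_gap[OF assms(2)]
        simp del: One_nat_def add_diff_assoc add_diff_assoc2 Nat.add_diff_assoc Nat.add_diff_assoc2)
  moreover have "1 \<le> r 1" "1 \<le> c 1" "r (Suc p) \<le> m" "c (Suc p) \<le> n"
    using assms(3) by (auto simp: region_iff)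
  ultimately show ?thesis
    using assms(4) unfolding in_band_def fst_conv snd_conv atLeastAtMost_iff by (intro conjI) linarith+
qed

text \<open>The \<open>q\<close>-th entries of the states of a walk trace a path going weakly up and to the right, so
  two boxes of a chain never lie on the same of the \<open>p\<close> paths.\<close>

lemma walk_filling_avoiding:
  assumes w: "w \<in> walks p duration start"
  shows "walk_filling w \<in> avoiding_fillings R (Suc p)"
proof -
  have "\<not> contains_I R (Suc p) (walk_filling w)"
  proof
    assume "contains_I R (Suc p) (walk_filling w)"
    then obtain r c where r: "strict_mono_on {1..Suc p} r" and c: "strict_mono_on {1..Suc p} c"
      and rc: "\<forall>s\<in>{1..Suc p}. (r s, c s) \<in> R \<and> walk_filling w (r s, c s) = 1"
      unfolding contains_I_region by blast
    have band: "in_band (r s, c s)" if "s \<in> {1..Suc p}" for s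
      using chain_in_band[OF r c] rc that by blast
    define \<tau> where "\<tau> s = time (r s, c s)" for s
    have \<tau>: "int (c s) = int (r s) + int (\<tau> s) + int p - int m" if "s \<in> {1..Suc p}" for s
      using band[OF that] by (auto simp: \<tau>_def time_def in_band_def of_nat_diff)
    have "\<exists>q<p. w ! \<tau> s ! q = int (r s) - int p" if s: "s \<in> {1..Suc p}" for s
    proof -
      have "int (r s) - int p \<in> positions (walk_filling w) (\<tau> s)"
        unfolding \<tau>_def using rc s band[OF s] by (subst positions_box) auto
      then have "int (r s) - int p \<in> set (w ! \<tau> s)"
        using time_le[OF band[OF s]] by (simp add: positions_walk_filling[OF w] \<tau>_def)
      then show ?thesis
        using length_walk[OF w time_le[OF band[OF s]]] by (auto simp: in_set_conv_nth \<tau>_def)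
    qed
    then obtain level where level: "\<And>s. s \<in> {1..Suc p} \<Longrightarrow>
        level s < p \<and> w ! \<tau> s ! level s = int (r s) - int p" by metis
    \<comment> \<open>Pigeonhole: \<open>p + 1\<close> boxes lie on \<open>p\<close> paths.\<close>
    have "\<not> inj_on level {1..Suc p}"
    proof
      assume "inj_on level {1..Suc p}"
      then have "card {1..Suc p} \<le> card {..<p}"
        using level by (intro card_inj_on_le[of level]) auto
      then show False by simp
    qed
    then obtain a b where ab: "a \<in> {1..Suc p}" "b \<in> {1..Suc p}" "level a = level b" "a \<noteq> b"
      by (auto simp: inj_on_def)
    have False if ab: "a \<in> {1..Suc p}" "b \<in> {1..Suc p}" "level a = level b" "a < b" for a b
    proof -
      have lt: "r a < r b" "c a < c b"
        using ab strict_mono_onD[OF r] strict_mono_onD[OF c] by auto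
      note l = level[OF ab(1)] level[OF ab(2)]
      have le: "\<tau> a \<le> duration" "\<tau> b \<le> duration"
        using time_le[OF band] ab by (auto simp: \<tau>_def)
      \<comment> \<open>On a common path the second box is weakly above the first if its time is not
        smaller, and weakly to the left otherwise.\<close>
      show False
      proof (cases "\<tau> a \<le> \<tau> b")
        case True
        have "w ! \<tau> b ! level a \<le> w ! \<tau> a ! level a"
          using walk_monotone[OF w _ True le(2), of "level a"] l by blast
        then show False using l lt ab(3) by simp
      next
        case False
        then have "w ! \<tau> b ! level a + int (\<tau> b) \<le> w ! \<tau> a ! level a + int (\<tau> a)"
          using walk_monotone[OF w _ _ le(1), of "level a" "\<tau> b"] l by simp
        then show False using l lt ab \<tau>[OF ab(1)] \<tau>[OF ab(2)] by simp
      qed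
    qed
    with ab show False by (metis linorder_neqE_nat)
  qed
  then show ?thesis by (auto simp: avoiding_fillings_def fillings_def walk_filling_def)
qed

lemma walk_filling_maximal:
  assumes w: "w \<in> walks p duration start"
  shows "walk_filling w \<in> maximal_fillings R (Suc p)"
  unfolding maximal_fillings_iff
proof (intro conjI ballI allI impI)
  show "walk_filling w \<in> avoiding_fillings R (Suc p)" by (rule walk_filling_avoiding[OF w])
  show "walk_filling w b = 1" if "b \<in> R" "\<not> in_band b" for b
    using that by (simp add: walk_filling_def)
  show "card (positions (walk_filling w) t) = p" if "t \<le> duration" for t
    using length_walk[OF w that] sorted_walk[OF w that]
    by (simp add: positions_walk_filling[OF w that] strict_sorted_iff distinct_card)
qed

lemma inj_on_walk_filling: "inj_on walk_filling (walks p duration start)"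
proof (rule inj_onI)
  fix w w' assume w: "w \<in> walks p duration start" and w': "w' \<in> walks p duration start"
    and eq: "walk_filling w = walk_filling w'"
  show "w = w'"
  proof (rule nth_equalityI)
    show "length w = length w'" using w w' by (simp add: walks_iff)
    fix t assume "t < length w"
    then have t: "t \<le> duration" using w by (simp add: walks_iff)
    have "set (w ! t) = set (w' ! t)"
      using eq positions_walk_filling[OF w t] positions_walk_filling[OF w' t] by simp
    then show "w ! t = w' ! t"
      using sorted_walk[OF w t] sorted_walk[OF w' t] by (metis strict_sorted_equal)
  qed
qed

text \<open>If two states crossed at position \<open>q\<close>, the entries of one up to \<open>q\<close> followed by those of
  the other from \<open>q\<close> on would give a chain of length \<open>p + 1\<close>.\<close>

lemma no_crossing:
  assumes F: "F \<in> avoiding_fillings R (Suc p)"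
    and a: "length a = p" "sorted_wrt (<) a" "set a \<subseteq> positions F t"
    and b: "length b = p" "sorted_wrt (<) b" "set b \<subseteq> positions F t'"
    and q: "q < p" "a ! q < b ! q" "a ! q + int t < b ! q + int t'"
  shows False
proof -
  define x where "x s = (if s \<le> q then a ! s else b ! (s - 1))" for s
  define \<tau> where "\<tau> s = (if s \<le> q then t else t')" for s
  have less: "a ! s < a ! s'" "b ! s < b ! s'" if "s < s'" "s' < p" for s s'
    using that a(1,2) b(1,2) by (auto intro!: sorted_wrt_nth_less)
  have b_mono: "b ! s \<le> b ! s'" if "s \<le> s'" "s' < p" for s s'
    using that less(2)[of s s'] by (cases "s = s'") auto
  have "x s < x s' \<and> x s + int (\<tau> s) < x s' + int (\<tau> s')" if s: "s < s'" "s' \<le> p" for s s'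
  proof -
    consider "s' \<le> q" | "q < s" | "s \<le> q" "q < s'" using s by linarith
    then show ?thesis
    proof cases
      case 1
      then show ?thesis using less(1)[of s s'] s q(1) by (simp add: x_def \<tau>_def)
    next
      case 2
      then show ?thesis using less(2)[of "s - 1" "s' - 1"] s by (simp add: x_def \<tau>_def)
    next
      case 3
      have "a ! s \<le> a ! q" using less(1)[of s q] 3 q(1) by (cases "s = q") auto
      moreover have "b ! q \<le> b ! (s' - 1)"
        using 3 s by (intro b_mono) linarith+
      ultimately show ?thesis using 3 q by (simp add: x_def \<tau>_def)
    qed
  qed
  moreover have "x s \<in> positions F (\<tau> s)" if "s \<le> p" for s
    using that q(1) a(1,3) b(1,3) nth_mem[of s a] nth_mem[of "s - 1" b] by (auto simp: x_def \<tau>_def)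
  ultimately show False using no_increasing_positions[OF F, of x \<tau>] by blast
qed

text \<open>\<open>no_crossing\<close> is used in both directions of time. Forwards, any increase of
  the entry also increases the column; backwards, this takes an increase by at least 2, which leaves
  exactly the two allowed steps.\<close>

lemma interlacing:
  assumes F: "F \<in> avoiding_fillings R (Suc p)"
    and card: "card (positions F t) = p" "card (positions F (Suc t)) = p" and q: "q < p"
  defines "a \<equiv> sorted_list_of_set (positions F t)"
    and "b \<equiv> sorted_list_of_set (positions F (Suc t))"
  shows "b ! q = a ! q \<or> b ! q = a ! q - 1"
proof -
  have a: "length a = p" "sorted_wrt (<) a" "set a \<subseteq> positions F t"
    and b: "length b = p" "sorted_wrt (<) b" "set b \<subseteq> positions F (Suc t)"
    using card finite_positions by (simp_all add: a_def b_def)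
  have "\<not> a ! q < b ! q" using no_crossing[OF F a b q] by auto
  moreover have "\<not> b ! q + 1 < a ! q" using no_crossing[OF F b a q] by auto
  ultimately show ?thesis by linarith
qed

text \<open>The inequalities of the region in the new coordinates; the last one turns the staircase
  into the wall.\<close>

lemma positions_bounds:
  assumes "x \<in> positions F t"
  shows "1 - int p \<le> x" "x \<le> int m - int p" "int m - 2 * int p + 1 \<le> x + int t"
    "x + int t \<le> int m + int n - 2 * int p" "2 * x \<le> int duration - int t"
proof -
  obtain i j where "(i, j) \<in> R" "x = int i - int p" "int j = x + int t + 2 * int p - int m"
    using assms unfolding positions_def by blast
  moreover have "int duration = int m + int n - 2 * int p"
    using p_less_m m_le_n by (simp add: duration_def of_nat_diff)
  ultimately show "1 - int p \<le> x" "x \<le> int m - int p" "int m - 2 * int p + 1 \<le> x + int t"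
    "x + int t \<le> int m + int n - 2 * int p" "2 * x \<le> int duration - int t"
    by (auto simp: region_iff)
qed

lemma start_unique:
  assumes "length z = p" and "sorted_wrt (<) z" and "set z \<subseteq> {int m - 2 * int p + 1..int m - int p}"
  shows "z = start"
proof -
  define d where "d = int m - int p"
  have "map (\<lambda>x. x - d) z = target p"
    using assms by (intro target_unique) (auto simp: sorted_wrt_map d_def)
  then have eq: "map (\<lambda>x. x - d) z ! i = target p ! i" for i by simp
  have "z ! i - d = int i + 1 - int p" if "i < p" for i
  proof -
    have "map (\<lambda>x. x - d) z ! i = z ! i - d" using that assms(1) by simp
    moreover have "target p ! i = int i + 1 - int p" using that by (simp add: target_def)
    ultimately show ?thesis using eq[of i] by simp
  qed
  then have "z ! i = start ! i" if "i < p" for i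
    using that by (force simp: start_def d_def)
  then show ?thesis using assms(1) by (intro nth_equalityI) (auto simp: start_def)
qed

text \<open>The sorted positions on successive diagonals form the walk: the extreme diagonals have
  only \<open>p\<close> boxes, which forces both ends, and \<open>interlacing\<close> gives the
  steps.\<close>

lemma walk_filling_surj:
  assumes F: "F \<in> maximal_fillings R (Suc p)"
  shows "F \<in> walk_filling ` walks p duration start"
proof -
  have avoid: "F \<in> avoiding_fillings R (Suc p)" and out: "\<And>b. b \<in> R \<Longrightarrow> \<not> in_band b \<Longrightarrow> F b = 1"
    and card: "\<And>t. t \<le> duration \<Longrightarrow> card (positions F t) = p"
    using F unfolding maximal_fillings_iff by auto
  define w where "w = map (\<lambda>t. sorted_list_of_set (positions F t)) [0..<Suc duration]"
  have nth: "w ! t = sorted_list_of_set (positions F t)" if "t \<le> duration" for t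
    using that unfolding w_def by (simp del: upt_Suc)
  have set: "set (w ! t) = positions F t" if "t \<le> duration" for t
    using that by (simp add: nth finite_positions)
  have state: "length (w ! t) = p" "sorted_wrt (<) (w ! t)" if "t \<le> duration" for t
    using that card[OF that] by (simp_all add: nth)
  have dur: "int duration = int m + int n - 2 * int p"
    using p_less_m m_le_n by (simp add: duration_def of_nat_diff)
  have w: "w \<in> walks p duration start"
    unfolding walks_iff
  proof (intro conjI allI impI)
    show "length w = Suc duration" by (simp add: w_def)
    show "w ! 0 = start"
      using state[of 0] positions_bounds[of _ F 0] by (intro start_unique) (force simp: set)+
    show "w ! duration = target p"
      using state[of duration] positions_bounds[of _ F duration]
      by (intro target_unique) (force simp: set dur)+
    fix t assume t: "t < duration"
    have "w ! Suc t ! q = w ! t ! q \<or> w ! Suc t ! q = w ! t ! q - 1" if "q < p" for q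
      using interlacing[OF avoid card card that, of t] t by (simp add: nth)
    moreover have "2 * w ! Suc t ! q \<le> int (duration - Suc t)" if "q < p" for q
    proof -
      have "w ! Suc t ! q \<in> positions F (Suc t)"
        using set[of "Suc t"] state(1)[of "Suc t"] t that nth_mem by fastforce
      then show ?thesis using positions_bounds(5) t by (fastforce simp: of_nat_diff)
    qed
    ultimately show "w ! Suc t \<in> steps p (duration - Suc t) (w ! t)"
      using state[of "Suc t"] t by (simp add: steps_def)
  qed
  have F01: "F \<in> R \<rightarrow>\<^sub>E {0, 1}" using avoid by (simp add: avoiding_fillings_def fillings_def)
  have "F = walk_filling w"
  proof (rule PiE_ext[OF F01])
    show "walk_filling w \<in> R \<rightarrow>\<^sub>E {0, 1}" by (auto simp: walk_filling_def)
    fix b assume b: "b \<in> R"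
    obtain i j where ij: "b = (i, j)" by (cases b)
    have "F b = 0 \<or> F b = 1" using F01 b by auto
    then show "F b = walk_filling w b"
      using b ij out[OF b] positions_box[of i j F] set[OF time_le[of b]]
      by (auto simp: walk_filling_def)
  qed
  with w show ?thesis by blast
qed

lemma card_maximal_fillings: "real (card (maximal_fillings R (Suc p))) =
  ballot_det p duration (\<lambda>i. start ! i)"
proof -
  have "bij_betw walk_filling (walks p duration start) (maximal_fillings R (Suc p))"
    using inj_on_walk_filling walk_filling_maximal walk_filling_surj
    by (intro bij_betw_imageI) auto
  then have "card (maximal_fillings R (Suc p)) = card (walks p duration start)"
    by (metis bij_betw_same_card)
  moreover have "finite (walks p duration start) \<and>
      real (card (walks p duration start)) = ballot_det p duration (\<lambda>i. start ! i)"
    using p_less_m m_le_n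
    by (intro card_walks) (auto simp: start_def sorted_wrt_iff_nth_less duration_def of_nat_diff)
  ultimately show ?thesis by simp
qed

end

section \<open>The product formula\<close>

lemma ballot_det_cong: "(\<And>i. i < p \<Longrightarrow> z i = z' i) \<Longrightarrow> ballot_det p s z = ballot_det p s z'"
  unfolding ballot_det_def by (intro arg_cong[where f = det] eq_matI) auto

lemma prod_falling: "i \<le> N \<Longrightarrow> (\<Prod>j<i. real (N - j)) = fact N / fact (N - i)"
proof (induction i)
  case (Suc i)
  have "(fact (N - i) :: real) = real (N - i) * fact (N - Suc i)"
    using Suc.prems by (metis Suc_diff_Suc Suc_le_eq fact_Suc of_nat_mult of_nat_fact)
  with Suc show ?case using Suc.prems by (simp add: field_simps)
qed simp

context band
begin

text \<open>The squares in \<open>ballot_det_eq\<close> factor into differences and sums. The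
  differences agree for \<open>y\<close> and \<open>Y\<close> and cancel, so only the sums
  \<open>g\<close> and \<open>G\<close> survive.\<close>

lemma ballot_det_start:
  "ballot_det p duration (\<lambda>i. start ! i) =
    (\<Prod>i<p. fact i * fact (m + n - 2 - 2 * i) / (fact (m - p + i) * fact (n + p - 1 - i))
       * (\<Prod>j<Suc i. real (n - m + 2 * p - 1 - (i + j))))"
proof -
  define u where "u i = m - p + i" for i
  define v where "v i = n + p - 1 - i" for i
  define y where "y i = real (v i) - real (u i)" for i
  define Y where "Y i = real (duration + 2 * p - 1) - 2 * real i" for i :: nat
  define g where "g c = real (n - m + 2 * p - 1 - c)" for c
  define G where "G c = real (m + n - 1 - c)" for c
  have dur: "duration + 2 * p - 1 = m + n - 1" using p_less_m m_le_n by (simp add: duration_def)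
  have sums: "y i + y j = 2 * g (i + j)" "Y i + Y j = 2 * G (i + j)" if "i < p" "j < p" for i j
    using that p_less_m m_le_n unfolding y_def Y_def u_def v_def g_def G_def dur
    by (auto simp: of_nat_diff algebra_simps)
  have diffs: "y i - y j = 2 * (real j - real i)" "Y i - Y j = 2 * (real j - real i)"
    if "i < p" "j < p" for i j
    using that p_less_m m_le_n unfolding y_def Y_def u_def v_def by (auto simp: of_nat_diff)
  have ratio: "((y i)\<^sup>2 - (y j)\<^sup>2) / ((Y i)\<^sup>2 - (Y j)\<^sup>2) = g (i + j) / G (i + j)"
    if "i < p" "j < i" for i j
  proof -
    have "(y i)\<^sup>2 - (y j)\<^sup>2 = 4 * (real j - real i) * g (i + j)"
      "(Y i)\<^sup>2 - (Y j)\<^sup>2 = 4 * (real j - real i) * G (i + j)"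
      using sums[of i j] diffs[of i j] that
      by (simp_all add: power2_eq_square square_diff_square_factored)
    then show ?thesis using that by simp
  qed
  \<comment> \<open>A product of consecutive integers; the factorial of its largest one cancels
    against \<open>ballot_det_eq\<close>.\<close>
  have G: "(\<Prod>j<Suc i. G (i + j)) = fact (m + n - 1 - i) / fact (m + n - 2 - 2 * i)" if "i < p" for i
  proof -
    have "(\<Prod>j<Suc i. G (i + j)) = (\<Prod>j<Suc i. real (m + n - 1 - i - j))"
      by (simp add: G_def)
    also have "\<dots> = fact (m + n - 1 - i) / fact (m + n - 1 - i - Suc i)"
      using that p_less_m m_le_n by (intro prod_falling) linarith
    also have "m + n - 1 - i - Suc i = m + n - 2 - 2 * i" by simp
    finally show ?thesis .
  qed
  have "ballot_det p duration (\<lambda>i. start ! i) = ballot_det p duration (\<lambda>i. int (u i) + 1 - int p)"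
    using p_less_m by (intro ballot_det_cong) (auto simp: start_def u_def of_nat_diff)
  also have "\<dots> = (\<Prod>i<p. fact i * fact (duration + 2 * p - 1 - i) / (fact (u i) * fact (v i)) * y i / Y i
       * (\<Prod>j<i. ((y i)\<^sup>2 - (y j)\<^sup>2) / ((Y i)\<^sup>2 - (Y j)\<^sup>2)))"
    unfolding y_def Y_def
    by (rule ballot_det_eq) (use p_less_m m_le_n in \<open>auto simp: u_def v_def duration_def\<close>)
  also have "\<dots> = (\<Prod>i<p. fact i * fact (m + n - 2 - 2 * i) / (fact (u i) * fact (v i))
       * (\<Prod>j<Suc i. g (i + j)))"
  proof (rule prod.cong[OF refl])
    fix i assume "i \<in> {..<p}"
    then have i: "i < p" by simp
    \<comment> \<open>Since \<open>y i = g (i + i)\<close> and \<open>Y i = G (i + i)\<close>, the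
      extra factor is the missing term \<open>j = i\<close>.\<close>
    have "y i / Y i * (\<Prod>j<i. ((y i)\<^sup>2 - (y j)\<^sup>2) / ((Y i)\<^sup>2 - (Y j)\<^sup>2))
        = (\<Prod>j<Suc i. g (i + j) / G (i + j))"
      using sums[OF i i] ratio[OF i] by simp
    also have "\<dots> = (\<Prod>j<Suc i. g (i + j)) * fact (m + n - 2 - 2 * i) / fact (m + n - 1 - i)"
      unfolding prod_dividef G[OF i] by simp
    finally have "fact i * fact (m + n - 1 - i) / (fact (u i) * fact (v i)) *
        (y i / Y i * (\<Prod>j<i. ((y i)\<^sup>2 - (y j)\<^sup>2) / ((Y i)\<^sup>2 - (Y j)\<^sup>2))) =
        fact i * fact (m + n - 1 - i) / (fact (u i) * fact (v i)) *
        ((\<Prod>j<Suc i. g (i + j)) * fact (m + n - 2 - 2 * i) / fact (m + n - 1 - i))" by simp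
    then show "fact i * fact (duration + 2 * p - 1 - i) / (fact (u i) * fact (v i)) * y i / Y i
       * (\<Prod>j<i. ((y i)\<^sup>2 - (y j)\<^sup>2) / ((Y i)\<^sup>2 - (Y j)\<^sup>2)) =
       fact i * fact (m + n - 2 - 2 * i) / (fact (u i) * fact (v i)) * (\<Prod>j<Suc i. g (i + j))"
      unfolding dur by (simp add: mult_ac del: prod.lessThan_Suc)
  qed
  finally show ?thesis by (simp only: u_def v_def g_def)
qed

text \<open>Substitution of \<open>p - i\<close> for \<open>i\<close> and \<open>p - j\<close> for
  \<open>j\<close>; the factor \<open>fact 0\<close> is dropped.\<close>

lemma card_maximal_fillings_product:
  "real (card (maximal_fillings R (Suc p))) =
     (\<Prod>i = 1..p. fact (m + n - 2 * Suc p + 2 * i) / (fact (m - i) * fact (n + i - 1)))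
     * (\<Prod>i = 1..p - 1. fact i) * (\<Prod>i = 1..p. \<Prod>j = i..p. real (n - m + i + j - 1))"
proof -
  define f where "f i = fact i * fact (m + n - 2 - 2 * i) / (fact (m - p + i) * fact (n + p - 1 - i))
       * (\<Prod>j<Suc i. real (n - m + 2 * p - 1 - (i + j)))" for i
  have rev: "prod h {..<p} = (\<Prod>i = 1..p. h (p - i))" for h :: "nat \<Rightarrow> real"
    by (rule prod.reindex_bij_witness[of _ "\<lambda>i. p - i" "\<lambda>i. p - i"]) auto
  have inner: "(\<Prod>j<Suc (p - i). real (n - m + 2 * p - 1 - (p - i + j))) =
      (\<Prod>j = i..p. real (n - m + i + j - 1))" if "i \<in> {1..p}" for i
    by (rule prod.reindex_bij_witness[of _ "\<lambda>j. p - j" "\<lambda>j. p - j"]) (use that in auto)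
  have f: "f (p - i) = fact (m + n - 2 * Suc p + 2 * i) / (fact (m - i) * fact (n + i - 1)) *
      fact (p - i) * (\<Prod>j = i..p. real (n - m + i + j - 1))" if i: "i \<in> {1..p}" for i
  proof -
    have "m + n - 2 - 2 * (p - i) = m + n - 2 * Suc p + 2 * i" "m - p + (p - i) = m - i"
      "n + p - 1 - (p - i) = n + i - 1"
      using i p_less_m m_le_n by auto
    then show ?thesis unfolding f_def inner[OF i] by simp
  qed
  have "{..<p} = insert 0 {1..p - 1}" using p_pos by auto
  then have "(\<Prod>i<p. fact i) = (\<Prod>i = 1..p - 1. fact i :: real)" by simp
  then have facts: "(\<Prod>i = 1..p. fact (p - i)) = (\<Prod>i = 1..p - 1. fact i :: real)"
    using rev[of fact] by simp
  have "real (card (maximal_fillings R (Suc p))) = (\<Prod>i = 1..p. f (p - i))"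
    unfolding card_maximal_fillings ballot_det_start rev[of f, symmetric]
    by (rule prod.cong[OF refl]) (simp only: f_def)
  also have "\<dots> = (\<Prod>i = 1..p. fact (m + n - 2 * Suc p + 2 * i) / (fact (m - i) * fact (n + i - 1)) *
      fact (p - i) * (\<Prod>j = i..p. real (n - m + i + j - 1)))"
    by (rule prod.cong[OF refl f])
  finally show ?thesis
    by (simp only: prod.distrib facts)
qed

end

section \<open>Reducing the smaller staircase to the larger one\<close>

lemma fillings_restrict: "F \<in> fillings R \<Longrightarrow> A \<subseteq> R \<Longrightarrow> restrict F A \<in> fillings A"
  unfolding fillings_def PiE_iff by (auto dest: subsetD)

text \<open>Boxes that can never take part in a forbidden pattern are all filled with 1 in a maximal
  filling.\<close>

lemma card_maximal_fillings_remove: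
  assumes fin: "finite R" and C: "C \<subseteq> R"
    and free: "\<And>F. contains_I R k F \<longleftrightarrow> contains_I (R - C) k F"
  shows "card (maximal_fillings R k) = card (maximal_fillings (R - C) k)"
proof -
  define res where "res F = restrict F (R - C)" for F :: "box \<Rightarrow> nat"
  define ext where "ext F = (\<lambda>b. if b \<in> C then 1 else F b)" for F :: "box \<Rightarrow> nat"
  have cong: "contains_I (R - C) k F \<longleftrightarrow> contains_I (R - C) k G"
    if "\<And>b. b \<in> R - C \<Longrightarrow> F b = G b" for F G
    unfolding contains_I_def using that by (intro ex_cong1 conj_cong refl ball_cong) metis
  have res: "res F \<in> avoiding_fillings (R - C) k" if "F \<in> avoiding_fillings R k" for F
    using that cong[of "res F" F] fillings_restrict[of F R "R - C"]
    by (auto simp: avoiding_fillings_def free res_def)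
  have ext: "ext F \<in> avoiding_fillings R k" if "F \<in> avoiding_fillings (R - C) k" for F
    using that C cong[of "ext F" F]
    by (auto simp: avoiding_fillings_def free ext_def fillings_def PiE_iff extensional_def)
  have num: "num_ones R F = num_ones (R - C) (res F) + card {b \<in> C. F b = 1}" for F
  proof -
    have "{b \<in> R. F b = 1} = {b \<in> R - C. res F b = 1} \<union> {b \<in> C. F b = 1}"
      using C by (auto simp: res_def)
    then show ?thesis
      unfolding num_ones_def using fin C finite_subset[OF C fin]
      by (simp only:) (rule card_Un_disjoint, auto)
  qed
  have le: "card {b \<in> C. F b = 1} \<le> card C" for F :: "box \<Rightarrow> nat"
    using finite_subset[OF C fin] by (intro card_mono) auto
  have res_ext: "res (ext F) = F" if "F \<in> fillings (R - C)" for F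
    using that by (auto simp: res_def ext_def fillings_def PiE_iff extensional_def)
  have num_ext: "num_ones R (ext F) = num_ones (R - C) F + card C" if "F \<in> fillings (R - C)" for F
    using num[of "ext F"] res_ext[OF that] by (simp add: ext_def)
  have "bij_betw ext (maximal_fillings (R - C) k) (maximal_fillings R k)"
  proof (rule bij_betw_imageI)
    show "inj_on ext (maximal_fillings (R - C) k)"
      by (rule inj_on_inverseI[of _ res])
        (auto simp: res_ext maximal_fillings_def avoiding_fillings_def)
    show "ext ` maximal_fillings (R - C) k = maximal_fillings R k"
    proof (intro equalityI subsetI)
      fix G assume "G \<in> ext ` maximal_fillings (R - C) k"
      then obtain F where F: "F \<in> maximal_fillings (R - C) k" "G = ext F" by blast
      then have avoid: "F \<in> avoiding_fillings (R - C) k" and fill: "F \<in> fillings (R - C)"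
        by (auto simp: maximal_fillings_def avoiding_fillings_def)
      have "num_ones R H \<le> num_ones R (ext F)" if "H \<in> avoiding_fillings R k" for H
        using F(1) res[OF that] le[of H] unfolding num_ext[OF fill] num[of H] maximal_fillings_def
        by (auto intro: add_mono)
      then show "G \<in> maximal_fillings R k"
        using ext[OF avoid] F(2) by (auto simp: maximal_fillings_def)
    next
      fix G assume G: "G \<in> maximal_fillings R k"
      then have avoid: "G \<in> avoiding_fillings R k"
        and max: "\<And>H. H \<in> avoiding_fillings R k \<Longrightarrow> num_ones R H \<le> num_ones R G"
        by (auto simp: maximal_fillings_def)
      have bound: "num_ones (R - C) H + card C \<le> num_ones (R - C) (res G) + card {b \<in> C. G b = 1}"
        if "H \<in> avoiding_fillings (R - C) k" for H
        using max[OF ext[OF that]] num_ext[of H] that by (simp add: num avoiding_fillings_def)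
      \<comment> \<open>Comparing \<open>G\<close> with the extension of its own restriction forces
        it to be 1 on all of \<open>C\<close>.\<close>
      have "card {b \<in> C. G b = 1} = card C"
        using bound[OF res[OF avoid]] le[of G] by simp
      then have "{b \<in> C. G b = 1} = C"
        using finite_subset[OF C fin] by (intro card_subset_eq) auto
      then have "G b = 1" if "b \<in> C" for b using that by blast
      \<comment> \<open>Outside \<open>R\<close> the default value of extensional functions must
        agree as well.\<close>
      moreover have "G b = undefined" if "b \<notin> R" for b
        using that avoid by (auto simp: avoiding_fillings_def fillings_def)
      ultimately have "G = ext (res G)"
        unfolding ext_def res_def by (intro HOL.ext) (simp add: restrict_def)
      moreover have "res G \<in> maximal_fillings (R - C) k"
        using bound le[of G] res[OF avoid] by (fastforce simp: maximal_fillings_def)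
      ultimately show "G \<in> ext ` maximal_fillings (R - C) k" by blast
    qed
  qed
  then show ?thesis by (metis bij_betw_same_card)
qed

lemma Rbar_wide_staircase:
  assumes "p < m" and "m \<le> n"
  shows "Rbar m n (m - p) = region m n p"
proof -
  have "(a, b) \<in> lower_right_staircase m n (m - p) \<longleftrightarrow> n + p < a + b"
    if "1 \<le> a" "a \<le> m" "1 \<le> b" "b \<le> n" for a b
  proof
    assume "(a, b) \<in> lower_right_staircase m n (m - p)"
    then show "n + p < a + b" using assms by (auto simp: lower_right_staircase_def)
  next
    assume "n + p < a + b"
    then show "(a, b) \<in> lower_right_staircase m n (m - p)"
      using assms that unfolding lower_right_staircase_def
      \<comment> \<open>The staircase begins below row \<open>p\<close>, so row \<open>a\<close>
        loses its last \<open>a - p\<close> boxes.\<close>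
      by (intro UN_I[of "a - p"]) auto
  qed
  then show ?thesis by (auto simp: Rbar_def rect_def region_iff)
qed

text \<open>In \<open>region m (Suc n) p\<close> the last column consists of the rows 1 to
  \<open>p\<close>; without it, the antidiagonal bound becomes \<open>n + Suc p\<close> on the first
  \<open>n\<close> columns.\<close>

lemma Rbar_narrow_staircase:
  assumes "p < m" and "m \<le> n"
  shows "Rbar m n (m - Suc p) = region m (Suc n) p - {..p} \<times> {Suc n}"
proof -
  have "(a, b) \<in> lower_right_staircase m n (m - Suc p) \<longleftrightarrow> n + Suc p < a + b"
    if "1 \<le> a" "a \<le> m" "1 \<le> b" "b \<le> n" for a b
  proof
    assume "(a, b) \<in> lower_right_staircase m n (m - Suc p)"
    then show "n + Suc p < a + b" using assms by (auto simp: lower_right_staircase_def)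
  next
    assume "n + Suc p < a + b"
    then show "(a, b) \<in> lower_right_staircase m n (m - Suc p)"
      using assms that unfolding lower_right_staircase_def
      by (intro UN_I[of "a - Suc p"]) auto
  qed
  then show ?thesis by (auto simp: Rbar_def rect_def region_iff le_Suc_eq)
qed

text \<open>All crossings of the rows and columns of a pattern lie in the region, so each of its
  columns has at least \<open>p + 1\<close> boxes, while the last column has
  \<open>p\<close>.\<close>

lemma card_maximal_fillings_last_column:
  assumes "p < m"
  shows "card (maximal_fillings (region m (Suc n) p) (Suc p)) =
    card (maximal_fillings (region m (Suc n) p - {..p} \<times> {Suc n}) (Suc p))"
proof -
  \<comment> \<open>The intersection discards row 0, so that \<open>C\<close> is contained in the
    region.\<close>
  define C where "C = region m (Suc n) p \<inter> {..p} \<times> {Suc n}"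
  have "c j \<noteq> Suc n"
    if r: "strict_mono_on {1..Suc p} r" and R: "\<forall>i\<in>{1..Suc p}. \<forall>j\<in>{1..Suc p}. (r i, c j) \<in> region m (Suc n) p"
      and j: "j \<in> {1..Suc p}" for r c :: "nat \<Rightarrow> nat" and j
  proof -
    have "r 1 + p \<le> r (Suc p)" using strict_mono_on_gap[OF r, of 1 "Suc p"] by simp
    moreover have "(r 1, c j) \<in> region m (Suc n) p" "(r (Suc p), c j) \<in> region m (Suc n) p"
      using R j by auto
    ultimately show ?thesis by (auto simp: region_iff)
  qed
  then have "contains_I (region m (Suc n) p) (Suc p) F \<longleftrightarrow>
      contains_I (region m (Suc n) p - C) (Suc p) F" for F
    unfolding contains_I_def C_def by (intro ex_cong1) (auto; blast)
  then have "card (maximal_fillings (region m (Suc n) p) (Suc p)) =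
      card (maximal_fillings (region m (Suc n) p - C) (Suc p))"
    by (intro card_maximal_fillings_remove) (auto simp: C_def finite_region)
  then show ?thesis by (simp add: C_def Diff_Int)
qed

theorem theorem1p3:
  fixes m n k t :: nat
  assumes "2 \<le> k" and "k \<le> m" and "m \<le> n"
    and "t = m - k \<or> t = m - k + 1"
  shows "real (card (maximal_fillings (Rbar m n t) k)) =
      (\<Prod>i = 1..k - 1. fact (m + n - 2 * k + 2 * i + kronecker_delta t (m - k)) /
                        (fact (m - i) * fact (n + i - 1 + kronecker_delta t (m - k))))
      * (\<Prod>i = 1..k - 2. fact i)
      * (\<Prod>i = 1..k - 1. \<Prod>j = i..k - 1. real (n - m + i + j - 1 + kronecker_delta t (m - k)))"
proof -
  define p where "p = k - 1"
  define d where "d = kronecker_delta t (m - k)"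
  have k: "k = Suc p" and p: "1 \<le> p" "p < m" using assms by (auto simp: p_def)
  \<comment> \<open>For \<open>t = m - k\<close> the shift \<open>d\<close> is 1, and the count is
    taken from the region with one more column.\<close>
  interpret band m "n + d" p
    using p assms by unfold_locales auto
  have "card (maximal_fillings (Rbar m n t) k) = card (maximal_fillings R (Suc p))"
  proof (cases "t = m - k")
    case True
    then show ?thesis
      using Rbar_narrow_staircase[OF p(2) assms(3)] card_maximal_fillings_last_column[OF p(2), of n]
      by (simp add: k d_def kronecker_delta_def)
  next
    case False
    then have "t = m - p" using assms(4) p by (simp add: k)
    then show ?thesis
      using False Rbar_wide_staircase[OF p(2) assms(3)] by (simp add: k d_def kronecker_delta_def)
  qed
  moreover have "(\<Prod>i = 1..p. fact (m + (n + d) - 2 * Suc p + 2 * i) / (fact (m - i) * fact (n + d + i - 1))) =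
      (\<Prod>i = 1..p. fact (m + n - 2 * k + 2 * i + d) / (fact (m - i) * fact (n + i - 1 + d)) :: real)"
  proof (rule prod.cong[OF refl])
    fix i assume "i \<in> {1..p}"
    then have "m + (n + d) - 2 * Suc p + 2 * i = m + n - 2 * k + 2 * i + d"
      "n + d + i - 1 = n + i - 1 + d"
      using assms k by auto
    then show "fact (m + (n + d) - 2 * Suc p + 2 * i) / (fact (m - i) * fact (n + d + i - 1)) =
      (fact (m + n - 2 * k + 2 * i + d) / (fact (m - i) * fact (n + i - 1 + d)) :: real)"
      by (simp only:)
  qed
  moreover have "(\<Prod>i = 1..p. \<Prod>j = i..p. real (n + d - m + i + j - 1)) =
      (\<Prod>i = 1..p. \<Prod>j = i..p. real (n - m + i + j - 1 + d))"
    using assms(3) by (intro prod.cong refl arg_cong[of _ _ real]) auto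
  ultimately show ?thesis
    unfolding d_def[symmetric] using card_maximal_fillings_product by (simp add: k)
qed

end
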